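(* Let $\Gamma=\Gamma(\alpha,\omega)$ be a lattice path polymatroid. Then the toric ideal of $\Gamma$ is generated by symmetric exchange binomials. Moreover, there exists a monomial order on the base ring of $\Gamma$ under which the symmetric exchange binomials form a Gröbner basis for the toric ideal.
   Context: Fix integers $n,r>0$. A lattice path is a sequence of unit steps, each north or east, from the origin to $(n,r)$. For lattice paths $\sigma,\tau$, write $\sigma\succeq\tau$ if for every $i\le n$ the $i$-th east step of $\sigma$ lies on or above the $i$-th east step of $\tau$. For a lattice path $\sigma$, $m(\sigma)$ is the monomial in $x_0,x_1,\ldots$ in which the degree of $x_i$ is the number of north steps of $\sigma$ along the vertical line $x=i$. Fix lattice paths $\alpha\succeq\omega$. The lattice path polymatroid $\Gamma(\alpha,\omega)$ is the discrete polymatroid whose bases are the monomials $m(\sigma)$ with $\alpha\succeq\sigma\succeq\omega$ (it consists of all divisors of these monomials). For bases $m,m'$ of a discrete polymatroid, if $d_i(m)>d_i(m')$, $d_j(m)<d_j(m')$ (where $d_k$ is the degree in $x_k$) and $\frac{x_j}{x_i}m$, $\frac{x_i}{x_j}m'$ are both bases, these are obtained from $m,m'$ by a symmetric exchange. The base ring is $\mathbb{C}[Y_m : m\text{ a basis}]$, and the toric ideal is the kernel of the $\mathbb{C}$-algebra map to $\mathbb{C}[x_0,x_1,\ldots]$ sending $Y_{m_1}\cdots Y_{m_t}\mapsto m_1\cdots m_t$. A symmetric exchange binomial is $Y_mY_{m'}-Y_nY_{n'}$ where $n,n'$ are obtained from $m,m'$ by a symmetric exchange. *)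

theory Defs
  imports Complex_Main "HOL-Library.Poly_Mapping" "HOL-Algebra.Ideal" "HOL-Algebra.QuotRing"
begin

text \<open>Monomials in variables from \<^typ>\<open>'v\<close> are written additively, as exponent vectors of type
  \<^typ>\<open>'v \<Rightarrow>\<^sub>0 nat\<close>; polynomials with complex coefficients have type
  \<^typ>\<open>('v \<Rightarrow>\<^sub>0 nat) \<Rightarrow>\<^sub>0 complex\<close>, whose multiplication in HOL-Library is the polynomial product.\<close>

type_synonym 'v monomial = "'v \<Rightarrow>\<^sub>0 nat"
type_synonym 'v cpoly = "'v monomial \<Rightarrow>\<^sub>0 complex"

definition mono_dvd :: "'v monomial \<Rightarrow> 'v monomial \<Rightarrow> bool"
  where "mono_dvd d m \<longleftrightarrow> (\<exists>k. m = d + k)"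

definition monomials :: "'v set \<Rightarrow> 'v monomial set"
  where "monomials V = {t. Poly_Mapping.keys t \<subseteq> V}"

definition monom :: "'v monomial \<Rightarrow> 'v cpoly"
  where "monom t = Poly_Mapping.single t 1"

definition poly_ring :: "'v set \<Rightarrow> 'v cpoly ring"
  where "poly_ring V =
    \<lparr>carrier = {p. Poly_Mapping.keys p \<subseteq> monomials V}, mult = (*), one = 1, zero = 0, add = (+)\<rparr>"


subsection \<open>Lattice path polymatroids\<close>

datatype step = North | East

definition lattice_path :: "nat \<Rightarrow> nat \<Rightarrow> step list \<Rightarrow> bool"
  where "lattice_path n r \<sigma> \<longleftrightarrow> count_list \<sigma> East = n \<and> count_list \<sigma> North = r"

text \<open>The heights of the east steps, in the order in which the path traverses them.\<close>

definition east_heights :: "step list \<Rightarrow> nat list"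
  where "east_heights \<sigma> =
    [count_list (take k \<sigma>) North. k \<leftarrow> [0..<length \<sigma>], \<sigma> ! k = East]"

definition path_above :: "step list \<Rightarrow> step list \<Rightarrow> bool"  (infix "\<succeq>" 50)
  where "\<sigma> \<succeq> \<tau> \<longleftrightarrow> list_all2 (\<ge>) (east_heights \<sigma>) (east_heights \<tau>)"

text \<open>A north step at position \<open>k\<close> of the path lies on the line \<open>x = i\<close>, where \<open>i\<close> is the number of
  preceding east steps.\<close>

definition path_monomial :: "step list \<Rightarrow> nat monomial"
  where "path_monomial \<sigma> =
    (\<Sum>k | k < length \<sigma> \<and> \<sigma> ! k = North. Poly_Mapping.single (count_list (take k \<sigma>) East) 1)"

definition lattice_path_polymatroid ::
    "nat \<Rightarrow> nat \<Rightarrow> step list \<Rightarrow> step list \<Rightarrow> nat monomial set"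
  where "lattice_path_polymatroid n r \<alpha> \<omega> =
    {d. \<exists>\<sigma>. lattice_path n r \<sigma> \<and> \<alpha> \<succeq> \<sigma> \<and> \<sigma> \<succeq> \<omega> \<and> mono_dvd d (path_monomial \<sigma>)}"

text \<open>The bases of a discrete polymatroid, given as the set of all its monomials, are the elements
  that are maximal under divisibility.\<close>

definition bases :: "'v monomial set \<Rightarrow> 'v monomial set"
  where "bases \<Gamma> = {m \<in> \<Gamma>. \<forall>m' \<in> \<Gamma>. mono_dvd m m' \<longrightarrow> m' = m}"


subsection \<open>Symmetric exchanges and the toric ideal\<close>

text \<open>The subtraction below is not truncated, since the exponents of \<open>x\<^sub>i\<close> in \<open>m\<close> and of \<open>x\<^sub>j\<close> in
  \<open>m'\<close> are positive.\<close>

definition symmetric_exchange :: "'v monomial set \<Rightarrow> 'v monomial \<Rightarrow> 'v monomial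
    \<Rightarrow> 'v monomial \<Rightarrow> 'v monomial \<Rightarrow> bool"
  where "symmetric_exchange \<Gamma> m m' u u' \<longleftrightarrow>
    m \<in> bases \<Gamma> \<and> m' \<in> bases \<Gamma> \<and> u \<in> bases \<Gamma> \<and> u' \<in> bases \<Gamma> \<and>
    (\<exists>i j. Poly_Mapping.lookup m i > Poly_Mapping.lookup m' i \<and>
           Poly_Mapping.lookup m j < Poly_Mapping.lookup m' j \<and>
           u = m - Poly_Mapping.single i 1 + Poly_Mapping.single j 1 \<and>
           u' = m' - Poly_Mapping.single j 1 + Poly_Mapping.single i 1)"

definition base_ring :: "'v monomial set \<Rightarrow> 'v monomial cpoly ring"
  where "base_ring \<Gamma> = poly_ring (bases \<Gamma>)"

definition Y :: "'v monomial \<Rightarrow> 'v monomial cpoly"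
  where "Y m = monom (Poly_Mapping.single m 1)"

definition symmetric_exchange_binomials :: "'v monomial set \<Rightarrow> 'v monomial cpoly set"
  where "symmetric_exchange_binomials \<Gamma> =
    {Y m * Y m' - Y u * Y u' | m m' u u'. symmetric_exchange \<Gamma> m m' u u'}"

text \<open>Evaluation of a polynomial in the \<open>Y\<^sub>m\<close> under the substitution of \<open>m\<close> for \<open>Y\<^sub>m\<close>.\<close>

definition toric_map :: "'v monomial cpoly \<Rightarrow> 'v cpoly"
  where "toric_map p = (\<Sum>t\<in>Poly_Mapping.keys p. Poly_Mapping.single 0 (Poly_Mapping.lookup p t) *
    (\<Prod>m\<in>Poly_Mapping.keys t. monom m ^ Poly_Mapping.lookup t m))"

definition toric_ideal :: "'v monomial set \<Rightarrow> 'v monomial cpoly set"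
  where "toric_ideal \<Gamma> = a_kernel (base_ring \<Gamma>) (poly_ring UNIV) toric_map"


subsection \<open>Monomial orders and Groebner bases\<close>

definition monomial_order :: "'v set \<Rightarrow> 'v monomial rel \<Rightarrow> bool"
  where "monomial_order V ord \<longleftrightarrow> well_order_on (monomials V) ord \<and>
    (\<forall>s t. (s, t) \<in> ord \<longrightarrow> (\<forall>w \<in> monomials V. (s + w, t + w) \<in> ord))"

text \<open>Meaningful for nonzero polynomials only.\<close>

definition leading_monomial :: "'v monomial rel \<Rightarrow> 'v cpoly \<Rightarrow> 'v monomial"
  where "leading_monomial ord p =
    (THE t. t \<in> Poly_Mapping.keys p \<and> (\<forall>s\<in>Poly_Mapping.keys p. (s, t) \<in> ord))"

definition initial_ideal :: "'v set \<Rightarrow> 'v monomial rel \<Rightarrow> 'v cpoly set \<Rightarrow> 'v cpoly set"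
  where "initial_ideal V ord F =
    Idl\<^bsub>poly_ring V\<^esub> {monom (leading_monomial ord f) | f. f \<in> F \<and> f \<noteq> 0}"

definition groebner_basis ::
    "'v set \<Rightarrow> 'v monomial rel \<Rightarrow> 'v cpoly set \<Rightarrow> 'v cpoly set \<Rightarrow> bool"
  where "groebner_basis V ord G I \<longleftrightarrow>
    finite G \<and> G \<subseteq> I \<and> initial_ideal V ord G = initial_ideal V ord I"


subsection \<open>Basic facts\<close>

lemma monomials_add: "s \<in> monomials V \<Longrightarrow> t \<in> monomials V \<Longrightarrow> s + t \<in> monomials V"
  using Poly_Mapping.keys_add[of s t] by (auto simp: monomials_def)

lemma poly_ring_cring: "cring (poly_ring V)"
proof -
  have add: "Poly_Mapping.keys (p + q) \<subseteq> monomials V"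
    if "Poly_Mapping.keys p \<subseteq> monomials V" "Poly_Mapping.keys q \<subseteq> monomials V" for p q :: "'a cpoly"
    using that Poly_Mapping.keys_add[of p q] by blast
  have mult: "Poly_Mapping.keys (p * q) \<subseteq> monomials V"
    if "Poly_Mapping.keys p \<subseteq> monomials V" "Poly_Mapping.keys q \<subseteq> monomials V" for p q :: "'a cpoly"
    using that Poly_Mapping.keys_mult[of p q] monomials_add by blast
  have 1: "Poly_Mapping.keys (1 :: 'a cpoly) \<subseteq> monomials V"
    by (auto simp: monomials_def)
  show ?thesis
  proof (rule cringI)
    show "abelian_group (poly_ring V)"
    proof (rule abelian_groupI)
      fix x assume "x \<in> carrier (poly_ring V)"
      then show "\<exists>y\<in>carrier (poly_ring V). y \<oplus>\<^bsub>poly_ring V\<^esub> x = \<zero>\<^bsub>poly_ring V\<^esub>"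
        by (intro bexI[of _ "- x"]) (auto simp: poly_ring_def)
    qed (auto simp: poly_ring_def add.assoc add.commute dest: add[THEN subsetD, rotated 2])
    show "Group.comm_monoid (poly_ring V)"
      by (rule comm_monoidI)
        (auto simp: poly_ring_def mult.assoc mult.commute
           intro: 1[simplified] dest: mult[THEN subsetD, rotated 2])
  qed (auto simp: poly_ring_def distrib_right)
qed

lemma toric_map_superset:
  assumes "finite S" "Poly_Mapping.keys p \<subseteq> S"
  shows "toric_map p = (\<Sum>t\<in>S. Poly_Mapping.single 0 (Poly_Mapping.lookup p t) *
    (\<Prod>m\<in>Poly_Mapping.keys t. monom m ^ Poly_Mapping.lookup t m))"
  unfolding toric_map_def using assms
  by (intro sum.mono_neutral_left) (auto simp: in_keys_iff)

lemma toric_map_add: "toric_map (p + q) = toric_map p + toric_map q"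
proof -
  let ?S = "Poly_Mapping.keys p \<union> Poly_Mapping.keys q"
  have "Poly_Mapping.keys (p + q) \<subseteq> ?S" by (rule Poly_Mapping.keys_add)
  then show ?thesis
    by (simp add: toric_map_superset[of ?S] lookup_add single_add distrib_right sum.distrib)
qed

lemma toric_map_0: "toric_map 0 = 0"
  by (simp add: toric_map_def)

lemma toric_map_sum: "toric_map (sum f A) = (\<Sum>a\<in>A. toric_map (f a))"
  by (induction A rule: infinite_finite_induct) (auto simp: toric_map_add toric_map_0)

lemma toric_map_single:
  "toric_map (Poly_Mapping.single t c) = Poly_Mapping.single 0 c *
    (\<Prod>m\<in>Poly_Mapping.keys t. monom m ^ Poly_Mapping.lookup t m)"
  by (subst toric_map_superset[of "{t}"]) auto

lemma toric_map_Y: "toric_map (Y m) = monom m"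
  by (simp add: Y_def monom_def toric_map_single mult_single)

lemma cpoly_expand: "(p :: 'v cpoly) =
  (\<Sum>t\<in>Poly_Mapping.keys p. Poly_Mapping.single t (Poly_Mapping.lookup p t))"
proof (rule poly_mapping_eqI)
  fix k
  show "Poly_Mapping.lookup p k = Poly_Mapping.lookup
    (\<Sum>t\<in>Poly_Mapping.keys p. Poly_Mapping.single t (Poly_Mapping.lookup p t)) k"
    by (simp add: lookup_sum lookup_single when_def sum.delta in_keys_iff)
qed

lemma toric_map_monomial_add:
  "(\<Prod>m\<in>Poly_Mapping.keys (s + t). monom m ^ Poly_Mapping.lookup (s + t) m) =
   (\<Prod>m\<in>Poly_Mapping.keys s. monom m ^ Poly_Mapping.lookup s m) *
   (\<Prod>m\<in>Poly_Mapping.keys t. monom m ^ Poly_Mapping.lookup t m)"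
proof -
  let ?S = "Poly_Mapping.keys s \<union> Poly_Mapping.keys t"
  have *: "(\<Prod>m\<in>Poly_Mapping.keys w. monom m ^ Poly_Mapping.lookup w m) =
     (\<Prod>m\<in>?S. monom m ^ Poly_Mapping.lookup w m)" if "Poly_Mapping.keys w \<subseteq> ?S" for w
    using that by (intro prod.mono_neutral_left) (auto simp: in_keys_iff)
  show ?thesis
    unfolding *[OF Poly_Mapping.keys_add] *[OF Un_upper1] *[OF Un_upper2]
    by (simp add: lookup_add power_add prod.distrib)
qed

lemma toric_map_mult: "toric_map (p * q) = toric_map p * toric_map q"
proof -
  have s: "toric_map (Poly_Mapping.single s c * Poly_Mapping.single t d) =
      toric_map (Poly_Mapping.single s c) * toric_map (Poly_Mapping.single t d)"
    for s t :: "'a monomial monomial" and c d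
  proof -
    have "Poly_Mapping.single (0 :: 'a monomial) (c * d) =
        Poly_Mapping.single 0 c * Poly_Mapping.single 0 d"
      by (simp add: mult_single)
    then show ?thesis
      by (simp only: mult_single[of s c t d] toric_map_single toric_map_monomial_add mult_ac)
  qed
  have "toric_map (p * q) = toric_map
    ((\<Sum>t\<in>Poly_Mapping.keys p. Poly_Mapping.single t (Poly_Mapping.lookup p t)) *
     (\<Sum>t\<in>Poly_Mapping.keys q. Poly_Mapping.single t (Poly_Mapping.lookup q t)))"
    using cpoly_expand[of p] cpoly_expand[of q] by simp
  also have "\<dots> = toric_map
      (\<Sum>t\<in>Poly_Mapping.keys p. Poly_Mapping.single t (Poly_Mapping.lookup p t)) *
    toric_map (\<Sum>t\<in>Poly_Mapping.keys q. Poly_Mapping.single t (Poly_Mapping.lookup q t))"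
    by (simp add: sum_product toric_map_sum s)
  finally show ?thesis using cpoly_expand[of p] cpoly_expand[of q] by simp
qed

lemma toric_map_ring_hom: "toric_map \<in> ring_hom (base_ring \<Gamma>) (poly_ring UNIV)"
proof (rule ring_hom_memI)
  have "toric_map (Poly_Mapping.single 0 1 :: 'a monomial cpoly) = Poly_Mapping.single 0 1"
    by (subst toric_map_single) simp
  then show "toric_map \<one>\<^bsub>base_ring \<Gamma>\<^esub> = \<one>\<^bsub>poly_ring UNIV\<^esub>"
    by (simp add: base_ring_def poly_ring_def)
qed (auto simp: base_ring_def poly_ring_def monomials_def toric_map_add toric_map_mult)

lemma path_monomial_degree:
  assumes "finite S" "{..length \<sigma>} \<subseteq> S"
  shows "(\<Sum>i\<in>S. Poly_Mapping.lookup (path_monomial \<sigma>) i) = count_list \<sigma> North"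
proof -
  let ?K = "{k. k < length \<sigma> \<and> \<sigma> ! k = North}"
  have mem: "count_list (take k \<sigma>) East \<in> S" for k
    using assms(2) count_le_length[of "take k \<sigma>" East] by (auto intro: order_trans)
  have "(\<Sum>i\<in>S. Poly_Mapping.lookup (path_monomial \<sigma>) i) =
      (\<Sum>k\<in>?K. \<Sum>i\<in>S. Poly_Mapping.lookup
        (Poly_Mapping.single (count_list (take k \<sigma>) East) (1::nat)) i)"
    by (simp add: path_monomial_def lookup_sum) (rule sum.swap)
  also have "\<dots> = card ?K"
    using assms(1) mem by (simp add: lookup_single when_def sum.delta)
  also have "\<dots> = count_list \<sigma> North"
    by (simp add: count_list_eq_length_filter length_filter_conv_card eq_commute)
  finally show ?thesis .
qed

lemma bases_lattice_path_polymatroid: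
  "bases (lattice_path_polymatroid n r \<alpha> \<omega>) =
    {path_monomial \<sigma> | \<sigma>. lattice_path n r \<sigma> \<and> \<alpha> \<succeq> \<sigma> \<and> \<sigma> \<succeq> \<omega>}"
    (is "bases ?\<Gamma> = ?B")
proof
  have dvd_refl: "mono_dvd d d" for d :: "nat monomial"
    unfolding mono_dvd_def by (rule exI[of _ 0]) simp
  have B: "b \<in> ?\<Gamma>" if "b \<in> ?B" for b
    using that dvd_refl unfolding lattice_path_polymatroid_def by blast
  show "bases ?\<Gamma> \<subseteq> ?B"
  proof
    fix m assume m: "m \<in> bases ?\<Gamma>"
    then obtain b where "b \<in> ?B" "mono_dvd m b"
      unfolding bases_def lattice_path_polymatroid_def by blast
    moreover have "b = m"
      using m B calculation unfolding bases_def by blast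
    ultimately show "m \<in> ?B" by simp
  qed
  show "?B \<subseteq> bases ?\<Gamma>"
  proof
    fix b assume "b \<in> ?B"
    then obtain \<sigma> where b: "b = path_monomial \<sigma>" and \<sigma>: "lattice_path n r \<sigma>" by blast
    have "m' = b" if "m' \<in> ?\<Gamma>" "mono_dvd b m'" for m'
    proof -
      from that obtain k l \<tau> where k: "m' = b + k" and l: "path_monomial \<tau> = m' + l"
        and \<tau>: "lattice_path n r \<tau>"
        unfolding mono_dvd_def lattice_path_polymatroid_def by blast
      let ?S = "{..length \<sigma>} \<union> {..length \<tau>} \<union> Poly_Mapping.keys k"
      have "(\<Sum>i\<in>?S. Poly_Mapping.lookup (path_monomial \<tau>) i) =
          (\<Sum>i\<in>?S. Poly_Mapping.lookup (path_monomial \<sigma>) i)"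
      proof -
        have "finite ?S" "{..length \<sigma>} \<subseteq> ?S" "{..length \<tau>} \<subseteq> ?S" by auto
        then show ?thesis
          using \<sigma> \<tau> by (simp only: path_monomial_degree lattice_path_def)
      qed
      moreover have "path_monomial \<tau> = path_monomial \<sigma> + k + l"
        using k l b by simp
      ultimately have "(\<Sum>i\<in>?S. Poly_Mapping.lookup k i) = 0"
        by (simp add: lookup_add sum.distrib)
      then have "Poly_Mapping.keys k = {}"
        unfolding sum_eq_0_iff[OF finite_UnI[OF finite_UnI[OF finite_atMost finite_atMost] finite_keys]]
        by (meson UnI2 equals0I in_keys_iff)
      then show ?thesis using k by simp
    qed
    then show "b \<in> bases ?\<Gamma>"
      using B[OF \<open>b \<in> ?B\<close>] unfolding bases_def by blast
  qed
qed

end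

theory Submission
  imports Defs "HOL-Computational_Algebra.Primes"
begin

text \<open>
  A base \<open>m\<close> is encoded by its heights \<open>h\<^sub>i = m\<^sub>0 + \<dots> + m\<^sub>i\<close>, that is, by the heights of the east steps
  of its path. Heights are additive in \<open>m\<close>, and the bases are the monomials whose heights lie
  between those of \<open>\<omega>\<close> and \<open>\<alpha>\<close>. A symmetric exchange moves \<open>h\<close> and \<open>h'\<close> in opposite directions by one
  along an interval.

  Give \<open>Y\<^sub>m\<close> the weight \<open>2n \<Sum>\<^sub>i h\<^sub>i\<^sup>2 - (\<Sum>\<^sub>i h\<^sub>i)\<^sup>2\<close>, up to a constant. A pair of bases that satisfies
  neither \<open>h \<le> h' \<le> h + 1\<close> nor \<open>h' \<le> h \<le> h' + 1\<close> admits a symmetric exchange that lowers its total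
  weight: the first term rewards bringing the heights closer together, and the second rewards
  comparability when the heights already differ by at most one. A product of variables all of whose
  pairs satisfy one of the two conditions is determined by its toric image, because its largest
  height vector is the average rounded up. So every monomial that is not the smallest in its fibre
  is divisible by the leading monomial of a symmetric exchange binomial.
\<close>


abbreviation lookup :: "('a \<Rightarrow>\<^sub>0 'b::zero) \<Rightarrow> 'a \<Rightarrow> 'b"
  where "lookup \<equiv> Poly_Mapping.lookup"

abbreviation keys :: "('a \<Rightarrow>\<^sub>0 'b::zero) \<Rightarrow> 'a set"
  where "keys \<equiv> Poly_Mapping.keys"

abbreviation single :: "'a \<Rightarrow> 'b \<Rightarrow> ('a \<Rightarrow>\<^sub>0 'b::zero)"
  where "single \<equiv> Poly_Mapping.single"


subsection \<open>The exponent vectors of toric images\<close>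

text \<open>The exponent of the monomial to which \<open>toric_map\<close> sends
  \<open>monom t\<close>. Its fibres are the sets of monomials with a common toric image.\<close>

definition toric_exp :: "'v monomial monomial \<Rightarrow> 'v monomial"
  where "toric_exp t = (\<Sum>m\<in>keys t. Poly_Mapping.map ((*) (lookup t m)) m)"

lemma lookup_map_times:
  "lookup (Poly_Mapping.map ((*) (c::nat)) m) i = c * lookup m i"
  by (simp add: Poly_Mapping.map.rep_eq when_def)

lemma lookup_toric_exp:
  assumes "finite S" "keys t \<subseteq> S"
  shows "lookup (toric_exp t) i = (\<Sum>m\<in>S. lookup t m * lookup m i)"
proof -
  have "lookup (toric_exp t) i = (\<Sum>m\<in>keys t. lookup t m * lookup m i)"
    by (simp add: toric_exp_def lookup_sum lookup_map_times)
  also have "\<dots> = (\<Sum>m\<in>S. lookup t m * lookup m i)"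
    using assms by (intro sum.mono_neutral_left) (auto simp: in_keys_iff)
  finally show ?thesis .
qed

lemma toric_exp_add: "toric_exp (s + t) = toric_exp s + toric_exp t"
proof (rule poly_mapping_eqI)
  fix i
  let ?S = "keys s \<union> keys t"
  have "keys (s + t) \<subseteq> ?S"
    by (rule Poly_Mapping.keys_add)
  then show "lookup (toric_exp (s + t)) i = lookup (toric_exp s + toric_exp t) i"
    by (simp add: lookup_add lookup_toric_exp[of ?S] distrib_right sum.distrib)
qed

lemma toric_exp_single_1: "toric_exp (single m 1) = m"
  by (rule poly_mapping_eqI) (simp add: lookup_toric_exp[of "{m}"])

lemma monom_power: "monom m ^ k = monom (Poly_Mapping.map ((*) k) m)"
proof (induction k)
  case 0
  have "Poly_Mapping.map ((*) 0) m = 0"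
    by (rule poly_mapping_eqI) (simp add: lookup_map_times)
  then show ?case by (simp only: power_0) (simp add: monom_def)
next
  case (Suc k)
  have "Poly_Mapping.map ((*) (Suc k)) m = m + Poly_Mapping.map ((*) k) m"
    by (rule poly_mapping_eqI) (simp add: lookup_map_times lookup_add)
  then show ?case
    unfolding power_Suc Suc.IH by (simp only: monom_def mult_single) simp
qed

lemma prod_monom: "(\<Prod>x\<in>A. monom (f x)) = monom (\<Sum>x\<in>A. f x)"
  by (induction A rule: infinite_finite_induct) (auto simp: monom_def mult_single)

lemma toric_map_single_exp: "toric_map (single t c) = single (toric_exp t) c"
  unfolding toric_map_single monom_power prod_monom toric_exp_def[symmetric]
  by (simp add: monom_def mult_single)

lemma toric_map_expand: "toric_map p = (\<Sum>t\<in>keys p. single (toric_exp t) (lookup p t))"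
  by (subst cpoly_expand) (simp only: toric_map_sum toric_map_single_exp)

text \<open>Only terms from the same fibre of \<open>toric_exp\<close> can cancel in the toric
  image. A polynomial in the kernel therefore has coefficient sum zero on every fibre.\<close>

lemma lookup_toric_map:
  "lookup (toric_map p) x = (\<Sum>t | t \<in> keys p \<and> toric_exp t = x. lookup p t)"
  unfolding toric_map_expand lookup_sum lookup_single when_def
  by (subst sum.inter_filter) auto

lemma toric_ideal_iff:
  "p \<in> toric_ideal \<Gamma> \<longleftrightarrow> keys p \<subseteq> monomials (bases \<Gamma>) \<and> toric_map p = 0"
  by (simp add: toric_ideal_def a_kernel_def' base_ring_def poly_ring_def)

lemma toric_ideal_ideal: "ideal (toric_ideal \<Gamma>) (base_ring \<Gamma>)"
  unfolding toric_ideal_def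
  by (intro ring_hom_ring.kernel_is_ideal ring_hom_ringI2 toric_map_ring_hom)
    (simp_all add: base_ring_def poly_ring_cring cring.axioms(1))

lemma Y_mult: "Y m * Y m' = monom (single m 1 + single m' 1)"
  by (simp add: Y_def monom_def mult_single)


subsection \<open>Ideals of polynomial rings\<close>

lemma poly_ring_ring: "ring (poly_ring V)"
  by (rule cring.axioms(1)[OF poly_ring_cring])

lemma
  assumes "ideal J (poly_ring V)"
  shows ideal_poly_ring_zero: "0 \<in> J"
    and ideal_poly_ring_add: "p \<in> J \<Longrightarrow> q \<in> J \<Longrightarrow> p + q \<in> J"
    and ideal_poly_ring_mult: "p \<in> J \<Longrightarrow> keys q \<subseteq> monomials V \<Longrightarrow> q * p \<in> J"
proof -
  interpret ideal J "poly_ring V" by fact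
  show "0 \<in> J" "p \<in> J \<Longrightarrow> q \<in> J \<Longrightarrow> p + q \<in> J"
    "p \<in> J \<Longrightarrow> keys q \<subseteq> monomials V \<Longrightarrow> q * p \<in> J"
    using additive_subgroup.zero_closed[OF additive_subgroup_axioms]
      additive_subgroup.a_closed[OF additive_subgroup_axioms, of p q] I_l_closed[of p q]
    by (simp_all add: poly_ring_def)
qed

lemma ideal_poly_ring_sum:
  assumes "ideal J (poly_ring V)" "\<And>x. x \<in> A \<Longrightarrow> f x \<in> J"
  shows "sum f A \<in> J"
  using assms(2)
  by (induction A rule: infinite_finite_induct)
    (auto intro: ideal_poly_ring_zero[OF assms(1)] ideal_poly_ring_add[OF assms(1)])

lemma single_sum_distrib: "single k (sum f A) = (\<Sum>x\<in>A. single k (f x))"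
  by (induction A rule: infinite_finite_induct) (auto simp: single_add)

lemma keys_monom: "keys (monom t) = {t}"
  by (simp add: monom_def)


subsection \<open>Leading monomials\<close>

lemma finite_has_greatest:
  assumes "linear_order_on A r" "finite S" "S \<noteq> {}" "S \<subseteq> A"
  shows "\<exists>t\<in>S. \<forall>s\<in>S. (s, t) \<in> r"
  using assms(2-4)
proof (induction S rule: finite_ne_induct)
  case (singleton x)
  then show ?case using assms(1) by (auto simp: order_on_defs refl_on_def)
next
  case (insert x S)
  then obtain t where t: "t \<in> S" "\<forall>s\<in>S. (s, t) \<in> r" by auto
  have refl: "(x, x) \<in> r" and tr: "trans r" and tot: "(x, t) \<in> r \<or> (t, x) \<in> r"
    using assms(1) insert.prems t(1)
    by (cases "x = t"; force simp: order_on_defs refl_on_def total_on_def)+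
  show ?case
  proof (cases "(x, t) \<in> r")
    case True
    then show ?thesis using t by auto
  next
    case False
    then have "(t, x) \<in> r" using tot by blast
    then have "\<forall>s\<in>insert x S. (s, x) \<in> r" using t refl transD[OF tr] by blast
    then show ?thesis by blast
  qed
qed

lemma leading_monomial_eqI:
  assumes "antisym ord" "t \<in> keys p" "\<And>s. s \<in> keys p \<Longrightarrow> (s, t) \<in> ord"
  shows "leading_monomial ord p = t"
  unfolding leading_monomial_def
  using assms by (intro the_equality) (auto dest: antisymD)

text \<open>The finite set of keys has a greatest element by linearity and only one by antisymmetry,
  so the description operator in \<open>leading_monomial\<close> is justified.\<close>

lemma
  assumes "linear_order_on (monomials V) ord" "p \<noteq> 0" "keys p \<subseteq> monomials V"
  shows leading_monomial_in_keys: "leading_monomial ord p \<in> keys p"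
    and leading_monomial_greatest: "s \<in> keys p \<Longrightarrow> (s, leading_monomial ord p) \<in> ord"
proof -
  obtain t where t: "t \<in> keys p" "\<forall>s\<in>keys p. (s, t) \<in> ord"
    using finite_has_greatest[OF assms(1), of "keys p"] assms(2,3) by auto
  moreover have "antisym ord" using assms(1) by (simp add: order_on_defs)
  ultimately have "leading_monomial ord p = t" by (intro leading_monomial_eqI) auto
  with t show "leading_monomial ord p \<in> keys p"
    "s \<in> keys p \<Longrightarrow> (s, leading_monomial ord p) \<in> ord" by auto
qed


subsection \<open>A criterion for generators and Groebner bases of toric ideals\<close>

lemma fibre_minimum:
  assumes ord: "monomial_order V ord" and "t \<in> monomials V"
  shows "\<exists>s\<in>monomials V. toric_exp s = toric_exp t \<and>
    (\<forall>u\<in>monomials V. toric_exp u = toric_exp t \<longrightarrow> (s, u) \<in> ord)"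
proof -
  have wf: "wf (ord - Id)" and lin: "linear_order_on (monomials V) ord"
    using ord by (auto simp: monomial_order_def well_order_on_def)
  let ?Q = "{s \<in> monomials V. toric_exp s = toric_exp t}"
  have "t \<in> ?Q" using assms by simp
  from wfE_min[OF wf this] obtain z
    where z: "z \<in> ?Q" "\<And>y. (y, z) \<in> ord - Id \<Longrightarrow> y \<notin> ?Q"
    by blast
  have "(z, u) \<in> ord" if u: "u \<in> ?Q" for u
  proof (cases "u = z")
    case True
    then show ?thesis using lin u by (auto simp: order_on_defs refl_on_def)
  next
    case False
    then have "(u, z) \<in> ord \<or> (z, u) \<in> ord"
      using lin z(1) u by (auto simp: order_on_defs total_on_def)
    then show ?thesis using z(2) u False by blast
  qed
  then show ?thesis using z(1) by blast
qed

text \<open>In \<open>reduce\<close>, the monomial \<open>s\<close> witnesses that \<open>t\<close>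
  is not least in its fibre; then some binomial of \<open>G\<close> must have a leading monomial
  \<open>a\<close> that divides \<open>t\<close>. This one condition gives both generation and the
  Groebner property.\<close>

locale toric_reduction =
  fixes \<Gamma> :: "'v monomial set" and ord :: "'v monomial monomial rel"
    and G :: "'v monomial cpoly set"
  assumes order: "monomial_order (bases \<Gamma>) ord"
    and G_finite: "finite G"
    and G_subset: "G \<subseteq> toric_ideal \<Gamma>"
    and reduce: "\<lbrakk>s \<in> monomials (bases \<Gamma>); t \<in> monomials (bases \<Gamma>); toric_exp s = toric_exp t;
        (s, t) \<in> ord; s \<noteq> t\<rbrakk> \<Longrightarrow>
      \<exists>a b c. t = a + c \<and> a \<in> monomials (bases \<Gamma>) \<and> b \<in> monomials (bases \<Gamma>) \<and>
        c \<in> monomials (bases \<Gamma>) \<and> (b, a) \<in> ord \<and> b \<noteq> a \<and> monom a - monom b \<in> G"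
begin

abbreviation "M \<equiv> monomials (bases \<Gamma>)"

lemma linear: "linear_order_on M ord" and wf_ord: "wf (ord - Id)"
  and ord_add: "(s, t) \<in> ord \<Longrightarrow> w \<in> M \<Longrightarrow> (s + w, t + w) \<in> ord"
  using order by (auto simp: monomial_order_def well_order_on_def)

lemma antisym: "antisym ord" and ord_refl: "s \<in> M \<Longrightarrow> (s, s) \<in> ord"
  using linear by (auto simp: order_on_defs refl_on_def)

lemma G_carrier: "G \<subseteq> carrier (base_ring \<Gamma>)"
  using G_subset by (fastforce simp: toric_ideal_iff base_ring_def poly_ring_def)

section \<open>Normal forms: the least monomial of each fibre\<close>

definition fibre_min :: "'v monomial \<Rightarrow> 'v monomial monomial"
  where "fibre_min x = (SOME s. s \<in> M \<and> toric_exp s = x \<and>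
    (\<forall>u\<in>M. toric_exp u = x \<longrightarrow> (s, u) \<in> ord))"

lemma fibre_min:
  assumes "t \<in> M"
  shows "fibre_min (toric_exp t) \<in> M" "toric_exp (fibre_min (toric_exp t)) = toric_exp t"
    "u \<in> M \<Longrightarrow> toric_exp u = toric_exp t \<Longrightarrow> (fibre_min (toric_exp t), u) \<in> ord"
proof -
  have "\<exists>s. s \<in> M \<and> toric_exp s = toric_exp t \<and>
      (\<forall>u\<in>M. toric_exp u = toric_exp t \<longrightarrow> (s, u) \<in> ord)"
    using fibre_minimum[OF order assms] by blast
  from someI_ex[OF this, folded fibre_min_def]
  show "fibre_min (toric_exp t) \<in> M" "toric_exp (fibre_min (toric_exp t)) = toric_exp t"
    "u \<in> M \<Longrightarrow> toric_exp u = toric_exp t \<Longrightarrow> (fibre_min (toric_exp t), u) \<in> ord"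
    by auto
qed

lemma ideal_Idl_G: "ideal (Idl\<^bsub>base_ring \<Gamma>\<^esub> G) (poly_ring (bases \<Gamma>))"
  using ring.genideal_ideal[OF poly_ring_ring G_carrier[unfolded base_ring_def]]
  by (simp add: base_ring_def)

lemma toric_exp_eq_of_G:
  assumes "monom a - monom b \<in> G"
  shows "toric_exp a = toric_exp b"
proof -
  have "monom a - monom b + monom b = (monom a :: 'v monomial cpoly)" by simp
  then have "toric_map (monom a) = toric_map (monom a - monom b) + toric_map (monom b)"
    by (metis toric_map_add)
  also have "toric_map (monom a - monom b) = 0"
    using assms G_subset by (auto simp: toric_ideal_iff)
  finally have "monom (toric_exp a) = (monom (toric_exp b) :: 'v cpoly)"
    by (simp add: monom_def toric_map_single_exp)
  then show ?thesis by (metis keys_monom singleton_inject)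
qed

text \<open>Well-founded induction along \<open>ord\<close>: rewriting \<open>t = a + c\<close> to
  \<open>b + c\<close> stays in the fibre, goes strictly down, and changes \<open>monom t\<close> by
  \<open>monom c * (monom a - monom b)\<close>, which lies in the ideal.\<close>

lemma monom_minus_fibre_min:
  assumes "t \<in> M"
  shows "monom t - monom (fibre_min (toric_exp t)) \<in> Idl\<^bsub>base_ring \<Gamma>\<^esub> G"
  using wf_ord assms
proof (induction t rule: wf_induct_rule)
  case (less t)
  let ?z = "fibre_min (toric_exp t)"
  note z = fibre_min[OF less.prems]
  show ?case
  proof (cases "?z = t")
    case True
    then show ?thesis using ideal_poly_ring_zero[OF ideal_Idl_G] by simp
  next
    case False
    then obtain a b c where abc: "t = a + c" "a \<in> M" "b \<in> M" "c \<in> M" "(b, a) \<in> ord" "b \<noteq> a"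
      "monom a - monom b \<in> G"
      using reduce[OF z(1) less.prems z(2) z(3)[OF less.prems refl]] by blast
    let ?u = "b + c"
    have "(?u, t) \<in> ord - Id" using abc ord_add by simp
    moreover have uM: "?u \<in> M" using abc monomials_add by blast
    ultimately have "monom ?u - monom (fibre_min (toric_exp ?u)) \<in> Idl\<^bsub>base_ring \<Gamma>\<^esub> G"
      by (rule less.IH)
    moreover have "toric_exp ?u = toric_exp t"
      using toric_exp_eq_of_G[OF abc(7)] abc(1) by (simp add: toric_exp_add)
    moreover have "monom c * (monom a - monom b) \<in> Idl\<^bsub>base_ring \<Gamma>\<^esub> G"
    proof (rule ideal_poly_ring_mult[OF ideal_Idl_G])
      show "monom a - monom b \<in> Idl\<^bsub>base_ring \<Gamma>\<^esub> G"
        using ring.genideal_self[OF poly_ring_ring G_carrier[unfolded base_ring_def]] abc(7)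
        by (auto simp: base_ring_def)
    qed (use abc in \<open>simp add: keys_monom\<close>)
    moreover have "monom c * (monom a - monom b) = monom t - monom ?u"
      using abc(1) by (simp add: monom_def right_diff_distrib mult_single add.commute)
    ultimately show ?thesis
      using ideal_poly_ring_add[OF ideal_Idl_G, of "monom t - monom ?u" "monom ?u - monom ?z"]
      by simp
  qed
qed

text \<open>Once the terms are grouped by fibre, each group has a single normal form, and its total
  coefficient is a coefficient of \<open>toric_map p\<close>.\<close>

lemma sum_fibre_min:
  assumes "toric_map p = 0"
  shows "(\<Sum>t\<in>keys p. single (fibre_min (toric_exp t)) (lookup p t)) = 0"
proof -
  have "(\<Sum>t\<in>keys p. single (fibre_min (toric_exp t)) (lookup p t)) =
      (\<Sum>x\<in>toric_exp ` keys p. \<Sum>t | t \<in> keys p \<and> toric_exp t = x.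
        single (fibre_min (toric_exp t)) (lookup p t))"
    by (rule sum.image_gen) simp
  also have "\<dots> = (\<Sum>x\<in>toric_exp ` keys p.
      single (fibre_min x) (\<Sum>t | t \<in> keys p \<and> toric_exp t = x. lookup p t))"
    by (intro sum.cong refl) (simp add: single_sum_distrib)
  also have "\<dots> = 0"
    using assms by (simp flip: lookup_toric_map)
  finally show ?thesis .
qed

theorem toric_ideal_eq: "toric_ideal \<Gamma> = Idl\<^bsub>base_ring \<Gamma>\<^esub> G"
proof
  show "Idl\<^bsub>base_ring \<Gamma>\<^esub> G \<subseteq> toric_ideal \<Gamma>"
    using ring.genideal_minimal[OF poly_ring_ring _ G_subset, of "bases \<Gamma>"]
      toric_ideal_ideal[of \<Gamma>] by (simp add: base_ring_def)
  show "toric_ideal \<Gamma> \<subseteq> Idl\<^bsub>base_ring \<Gamma>\<^esub> G"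
  proof
    fix p assume p: "p \<in> toric_ideal \<Gamma>"
    let ?z = "\<lambda>t. fibre_min (toric_exp t)"
    \<comment> \<open>The subtracted sum of normal forms is zero; it serves to pair each term with
      its normal form.\<close>
    have "p = (\<Sum>t\<in>keys p. single t (lookup p t)) - (\<Sum>t\<in>keys p. single (?z t) (lookup p t))"
      using p sum_fibre_min[of p] cpoly_expand[of p] by (simp add: toric_ideal_iff)
    also have "\<dots> = (\<Sum>t\<in>keys p. single 0 (lookup p t) * (monom t - monom (?z t)))"
      by (simp add: monom_def right_diff_distrib mult_single flip: sum_subtractf)
    also have "\<dots> \<in> Idl\<^bsub>base_ring \<Gamma>\<^esub> G"
    proof (intro ideal_poly_ring_sum[OF ideal_Idl_G] ideal_poly_ring_mult[OF ideal_Idl_G])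
      fix t assume "t \<in> keys p"
      then show "monom t - monom (?z t) \<in> Idl\<^bsub>base_ring \<Gamma>\<^esub> G"
        using p by (intro monom_minus_fibre_min) (auto simp: toric_ideal_iff)
    qed (simp add: monomials_def)
    finally show "p \<in> Idl\<^bsub>base_ring \<Gamma>\<^esub> G" .
  qed
qed

section \<open>Initial ideals\<close>

lemma leading_monomials_carrier:
  assumes "F \<subseteq> toric_ideal \<Gamma>"
  shows "{monom (leading_monomial ord f) | f. f \<in> F \<and> f \<noteq> 0} \<subseteq> carrier (poly_ring (bases \<Gamma>))"
proof clarify
  fix f assume "f \<in> F" "f \<noteq> 0"
  then have "leading_monomial ord f \<in> M"
    using assms leading_monomial_in_keys[OF linear, of f] toric_ideal_iff[of f \<Gamma>] by blast
  then show "monom (leading_monomial ord f) \<in> carrier (poly_ring (bases \<Gamma>))"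
    by (simp add: poly_ring_def keys_monom)
qed

theorem groebner: "groebner_basis (bases \<Gamma>) ord G (toric_ideal \<Gamma>)"
  unfolding groebner_basis_def
proof (intro conjI G_finite G_subset)
  let ?R = "poly_ring (bases \<Gamma>)"
  let ?L = "\<lambda>F. {monom (leading_monomial ord f) | f. f \<in> F \<and> f \<noteq> 0}"
  note carr = leading_monomials_carrier[OF G_subset] leading_monomials_carrier[OF subset_refl]
  have id: "ideal (Idl\<^bsub>?R\<^esub> ?L G) ?R"
    by (rule ring.genideal_ideal[OF poly_ring_ring carr(1)])
  have "?L (toric_ideal \<Gamma>) \<subseteq> Idl\<^bsub>?R\<^esub> ?L G"
  proof clarify
    fix f assume f: "f \<in> toric_ideal \<Gamma>" "f \<noteq> 0"
    define t where "t = leading_monomial ord f"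
    have fM: "keys f \<subseteq> M" and f0: "toric_map f = 0" using f(1) by (auto simp: toric_ideal_iff)
    have t: "t \<in> keys f" "\<And>s. s \<in> keys f \<Longrightarrow> (s, t) \<in> ord"
      using leading_monomial_in_keys[OF linear f(2) fM]
        leading_monomial_greatest[OF linear f(2) fM] by (auto simp: t_def)
    \<comment> \<open>A leading term alone in its fibre would survive in the toric image. The second
      term \<open>s\<close> lies below \<open>t\<close>, so \<open>reduce\<close> applies to the
      pair.\<close>
    have "\<exists>s\<in>keys f. s \<noteq> t \<and> toric_exp s = toric_exp t"
    proof (rule ccontr)
      assume "\<not> ?thesis"
      then have "{s. s \<in> keys f \<and> toric_exp s = toric_exp t} = {t}" using t(1) by blast
      then have "lookup f t = 0"
        using lookup_toric_map[of f "toric_exp t"] f0 by simp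
      then show False using t(1) by (simp add: in_keys_iff)
    qed
    then obtain s where s: "s \<in> keys f" "s \<noteq> t" "toric_exp s = toric_exp t" by blast
    then obtain a b c where abc: "t = a + c" "a \<in> M" "b \<in> M" "c \<in> M" "(b, a) \<in> ord" "b \<noteq> a"
      "monom a - monom b \<in> G"
      using reduce[of s t] fM t by blast
    let ?g = "monom a - monom b"
    have k: "keys ?g = {a, b}"
      using abc(6) by (auto simp: monom_def in_keys_iff lookup_minus lookup_single when_def split: if_splits)
    then have "leading_monomial ord ?g = a" "?g \<noteq> 0"
      using abc ord_refl by (auto intro!: leading_monomial_eqI[OF antisym])
    then have "monom a \<in> ?L G" using abc(7) by force
    then have "monom a \<in> Idl\<^bsub>?R\<^esub> ?L G"
      using ring.genideal_self[OF poly_ring_ring carr(1)] by blast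
    then have "monom c * monom a \<in> Idl\<^bsub>?R\<^esub> ?L G"
      using abc(4) by (intro ideal_poly_ring_mult[OF id]) (simp_all add: keys_monom)
    then show "monom (leading_monomial ord f) \<in> Idl\<^bsub>?R\<^esub> ?L G"
      using abc(1) by (simp add: t_def[symmetric] monom_def mult_single add.commute)
  qed
  then have "Idl\<^bsub>?R\<^esub> ?L (toric_ideal \<Gamma>) \<subseteq> Idl\<^bsub>?R\<^esub> ?L G"
    by (rule ring.genideal_minimal[OF poly_ring_ring id])
  moreover have "Idl\<^bsub>?R\<^esub> ?L G \<subseteq> Idl\<^bsub>?R\<^esub> ?L (toric_ideal \<Gamma>)"
    using G_subset by (intro ring.subset_Idl_subset[OF poly_ring_ring carr(2)]) blast
  ultimately show "initial_ideal (bases \<Gamma>) ord G = initial_ideal (bases \<Gamma>) ord (toric_ideal \<Gamma>)"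
    by (simp add: initial_ideal_def)
qed

end


subsection \<open>Monomial orders from weights\<close>

text \<open>Summing over the fixed set \<open>V\<close> instead of \<open>keys t\<close> makes
  additivity immediate.\<close>

definition weight :: "'v set \<Rightarrow> ('v \<Rightarrow> nat) \<Rightarrow> 'v monomial \<Rightarrow> nat"
  where "weight V w t = (\<Sum>m\<in>V. lookup t m * w m)"

lemma weight_add: "weight V w (s + t) = weight V w s + weight V w t"
  by (simp add: weight_def lookup_add distrib_right sum.distrib)

lemma weight_single: "finite V \<Longrightarrow> m \<in> V \<Longrightarrow> weight V w (single m 1) = w m"
  by (simp add: weight_def lookup_single when_def if_distrib if_distribR cong: if_cong)

text \<open>Ties between monomials of equal weight are broken by the products \<open>P t\<close> of
  prime powers; these are injective in \<open>t\<close>.\<close>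

lemma monomial_order_of_weight:
  fixes w :: "'v \<Rightarrow> nat"
  assumes V: "finite V"
  shows "\<exists>ord. monomial_order V ord \<and>
    (\<forall>s\<in>monomials V. \<forall>t\<in>monomials V. weight V w s < weight V w t \<longrightarrow> (s, t) \<in> ord)"
proof -
  obtain B :: "nat set" where B: "finite B" "card B = card V" "B \<subseteq> {q. prime q}"
    using infinite_arbitrarily_large[OF primes_infinite] by blast
  then obtain p where p: "p ` V \<subseteq> B" "inj_on p V"
    using card_le_inj[OF V, of B] by auto
  have prime_p: "prime (p m)" if "m \<in> V" for m using that p(1) B(3) by blast
  define P where "P t = (\<Prod>m\<in>V. p m ^ lookup t m)" for t :: "'v monomial"
  have P_pos: "P t > 0" for t using prime_p by (auto simp: P_def prime_gt_0_nat intro!: prod_pos)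
  have P_add: "P (s + t) = P s * P t" for s t
    by (simp add: P_def lookup_add power_add prod.distrib)
  have mult: "multiplicity (p m) (P t) = lookup t m" if "m \<in> V" for m t
  proof -
    have "P t = (\<Prod>q\<in>p ` V. q ^ lookup t (inv_into V p q))"
      unfolding P_def prod.reindex[OF p(2)] using p(2) by (intro prod.cong) auto
    then show ?thesis
      using that p(2) prime_p V
      by (simp, subst multiplicity_prod_prime_powers) auto
  qed
  have P_inj: "s = t" if "s \<in> monomials V" "t \<in> monomials V" "P s = P t" for s t
  proof (rule poly_mapping_eqI)
    fix m
    show "lookup s m = lookup t m"
    proof (cases "m \<in> V")
      case True
      then show ?thesis using that(3) mult[of m s] mult[of m t] by simp
    next
      case False
      then have "lookup s m = 0" "lookup t m = 0"
        using that(1,2) unfolding monomials_def by (meson CollectD in_keys_iff subsetD)+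
      then show ?thesis by simp
    qed
  qed
  define ord where "ord = {(s, t). s \<in> monomials V \<and> t \<in> monomials V \<and>
    (weight V w s < weight V w t \<or> weight V w s = weight V w t \<and> P s \<le> P t)}"
  have "linear_order_on (monomials V) ord"
    unfolding order_on_defs
  proof (intro conjI)
    show "antisym ord" by (rule antisymI, rule P_inj) (auto simp: ord_def)
  qed (auto simp: ord_def refl_on_def trans_def total_on_def)
  moreover have "wf (ord - Id)"
  proof (rule wf_subset)
    show "wf (inv_image (less_than <*lex*> less_than) (\<lambda>t. (weight V w t, P t)))" by auto
    show "ord - Id \<subseteq> inv_image (less_than <*lex*> less_than) (\<lambda>t. (weight V w t, P t))"
      using P_inj by (fastforce simp: ord_def order_le_less)
  qed
  moreover have "(s + u, t + u) \<in> ord" if "(s, t) \<in> ord" "u \<in> monomials V" for s t u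
    using that P_pos[of u] by (auto simp: ord_def weight_add P_add intro: monomials_add)
  ultimately have "monomial_order V ord"
    by (auto simp: monomial_order_def well_order_on_def)
  then show ?thesis by (intro exI[of _ ord]) (auto simp: ord_def)
qed


subsection \<open>Symmetric exchange binomials\<close>

lemma monomials_subset: "keys t' \<subseteq> keys t \<Longrightarrow> t \<in> monomials V \<Longrightarrow> t' \<in> monomials V"
  by (simp add: monomials_def)

lemma split_variable:
  assumes "h \<in> keys (t :: 'a monomial)"
  shows "\<exists>t'. t = single h 1 + t' \<and> keys t' \<subseteq> keys t"
proof (intro exI conjI)
  show "t = single h 1 + (t - single h 1)"
    by (rule poly_mapping_eqI)
      (use assms in \<open>auto simp: lookup_add lookup_minus lookup_single when_def in_keys_iff\<close>)
  show "keys (t - single h 1) \<subseteq> keys t"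
    by (auto simp: in_keys_iff lookup_minus)
qed

lemma exchange_preserves_product:
  assumes "symmetric_exchange \<Gamma> m m' u u'"
  shows "m + m' = u + u'"
  using assms unfolding symmetric_exchange_def
  by (intro poly_mapping_eqI) (auto simp: lookup_add lookup_minus lookup_single when_def)

lemma finite_symmetric_exchange_binomials:
  assumes "finite (bases \<Gamma>)"
  shows "finite (symmetric_exchange_binomials \<Gamma>)"
proof (rule finite_subset)
  let ?B = "bases \<Gamma>"
  show "symmetric_exchange_binomials \<Gamma> \<subseteq>
      (\<lambda>(m, m', u, u'). Y m * Y m' - Y u * Y u') ` (?B \<times> ?B \<times> ?B \<times> ?B)"
    by (force simp: symmetric_exchange_binomials_def symmetric_exchange_def)
  show "finite ((\<lambda>(m, m', u, u'). Y m * Y m' - Y u * Y u') ` (?B \<times> ?B \<times> ?B \<times> ?B))"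
    using assms by simp
qed

lemma pair_in_monomials:
  "m \<in> V \<Longrightarrow> m' \<in> V \<Longrightarrow> single m (1::nat) + single m' 1 \<in> monomials V"
  by (rule monomials_add) (simp_all add: monomials_def)

lemma symmetric_exchange_binomials_toric:
  "symmetric_exchange_binomials \<Gamma> \<subseteq> toric_ideal \<Gamma>"
proof
  fix p assume "p \<in> symmetric_exchange_binomials \<Gamma>"
  then obtain m m' u u' where p: "p = Y m * Y m' - Y u * Y u'"
    and ex: "symmetric_exchange \<Gamma> m m' u u'"
    unfolding symmetric_exchange_binomials_def by blast
  have B: "m \<in> bases \<Gamma>" "m' \<in> bases \<Gamma>" "u \<in> bases \<Gamma>" "u' \<in> bases \<Gamma>"
    using ex by (auto simp: symmetric_exchange_def)
  have "keys p \<subseteq> {single m 1 + single m' 1, single u 1 + single u' 1}"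
    unfolding p Y_mult monom_def
    by (auto simp: in_keys_iff lookup_minus lookup_single when_def split: if_splits)
  also have "\<dots> \<subseteq> monomials (bases \<Gamma>)"
    using B pair_in_monomials by auto
  finally have "keys p \<subseteq> monomials (bases \<Gamma>)" .
  moreover have "toric_map p + toric_map (Y u * Y u') = toric_map (Y m * Y m')"
    by (simp add: p flip: toric_map_add)
  then have "toric_map p = 0"
    using exchange_preserves_product[OF ex]
    by (simp add: toric_map_mult toric_map_Y monom_def mult_single)
  ultimately show "p \<in> toric_ideal \<Gamma>" by (simp add: toric_ideal_iff)
qed


subsection \<open>Heights of lattice paths\<close>

definition height :: "nat monomial \<Rightarrow> nat \<Rightarrow> nat"
  where "height m i = (\<Sum>j\<le>i. lookup m j)"

lemma height_add: "height (m + m') i = height m i + height m' i"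
  by (simp add: height_def lookup_add sum.distrib)

lemma height_single: "height (single j c) i = (if j \<le> i then c else 0)"
  by (simp add: height_def lookup_single when_def)

lemma height_0: "height m 0 = lookup m 0"
  and height_Suc: "height m (Suc i) = height m i + lookup m (Suc i)"
  by (simp_all add: height_def)

lemma height_mono: "i \<le> j \<Longrightarrow> height m i \<le> height m j"
  unfolding height_def by (rule sum_mono2) auto

lemma height_inject:
  assumes "\<And>i. height m i = height m' i"
  shows "m = m'"
proof (rule poly_mapping_eqI)
  fix k
  show "lookup m k = lookup m' k"
    using assms[of k] assms[of "k - 1"] by (cases k) (auto simp: height_0 height_Suc)
qed

lemma height_toric_exp:
  assumes "finite S" "keys t \<subseteq> S"
  shows "height (toric_exp t) i = (\<Sum>m\<in>S. lookup t m * height m i)"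
  unfolding height_def lookup_toric_exp[OF assms] by (subst sum.swap) (simp add: sum_distrib_left)

section \<open>From paths to heights of monomials and back\<close>

lemma path_monomial_Nil: "path_monomial [] = 0"
  by (simp add: path_monomial_def)

lemma height_path_monomial:
  "height (path_monomial \<sigma>) i =
    (\<Sum>k | k < length \<sigma> \<and> \<sigma> ! k = North. if count_list (take k \<sigma>) East \<le> i then 1 else 0)"
  unfolding height_def path_monomial_def lookup_sum
  by (subst sum.swap) (simp add: lookup_single when_def cong: if_cong)

lemma
  shows height_path_monomial_North:
      "height (path_monomial (North # \<sigma>)) i = Suc (height (path_monomial \<sigma>) i)" (is ?N)
    and height_path_monomial_East:
      "height (path_monomial (East # \<sigma>)) i =
        (case i of 0 \<Rightarrow> 0 | Suc i \<Rightarrow> height (path_monomial \<sigma>) i)" (is ?E)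
proof -
  let ?K = "{k. k < length \<sigma> \<and> \<sigma> ! k = North}"
  have K: "{k. k < length (s # \<sigma>) \<and> (s # \<sigma>) ! k = North} =
      (if s = North then {0} else {}) \<union> Suc ` ?K" for s
    by (auto simp: less_Suc_eq_0_disj)
  have 0: "0 \<notin> Suc ` ?K" by blast
  show ?N
    unfolding height_path_monomial K by (simp add: 0 sum.reindex)
  show ?E
    unfolding height_path_monomial K by (simp add: sum.reindex split: nat.split)
qed

lemma east_heights_Cons:
  "east_heights (North # \<sigma>) = map Suc (east_heights \<sigma>)"
  "east_heights (East # \<sigma>) = 0 # east_heights \<sigma>"
  by (simp_all add: east_heights_def upt_conv_Cons map_concat comp_def if_distrib
      del: upt_Suc flip: map_Suc_upt cong: if_cong)

lemma east_heights_path_monomial: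
  "east_heights \<sigma> = map (height (path_monomial \<sigma>)) [0..<count_list \<sigma> East]"
proof (induction \<sigma>)
  case Nil
  then show ?case by (simp add: east_heights_def)
next
  case (Cons s \<sigma>)
  then show ?case
    by (cases s) (simp_all add: east_heights_Cons height_path_monomial_North
      height_path_monomial_East upt_conv_Cons del: upt_Suc flip: map_Suc_upt)
qed

lemma height_path_monomial_eq_North:
  "count_list \<sigma> East \<le> i \<Longrightarrow> height (path_monomial \<sigma>) i = count_list \<sigma> North"
proof (induction \<sigma> arbitrary: i)
  case Nil
  then show ?case by (simp add: path_monomial_Nil height_def)
next
  case (Cons s \<sigma>)
  then show ?case
    by (cases s) (auto simp: height_path_monomial_North height_path_monomial_East split: nat.split)
qed

lemma height_path_monomial_replicate:
  "height (path_monomial (replicate a North @ \<sigma>)) i = a + height (path_monomial \<sigma>) i"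
  by (induction a) (simp_all add: height_path_monomial_North)

lemma count_list_replicate: "count_list (replicate k x) y = (if x = y then k else 0)"
  by (induction k) auto

text \<open>The path is built line by line: \<open>lookup m 0\<close> north steps on the first line,
  one east step, then a path for the remaining variables.\<close>

lemma lattice_path_of_heights:
  assumes "\<And>i. n \<le> i \<Longrightarrow> height m i = r"
  shows "\<exists>\<sigma>. lattice_path n r \<sigma> \<and> path_monomial \<sigma> = m"
  using assms
proof (induction n arbitrary: m r)
  case 0
  then have "path_monomial (replicate r North @ []) = m"
    by (intro height_inject) (simp only: height_path_monomial_replicate,
      simp add: path_monomial_Nil height_def)
  moreover have "lattice_path 0 r (replicate r North @ [])"
    by (induction r) (simp_all add: lattice_path_def)
  ultimately show ?case by blast
next
  case (Suc n)
  \<comment> \<open>This drops the variable with index 0 and shifts the others down by one.\<close>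
  define m' where "m' = Poly_Mapping.map_key Suc m"
  have m': "lookup m' i = lookup m (Suc i)" for i
    by (simp add: m'_def Poly_Mapping.map_key.rep_eq)
  have height_m': "height m (Suc i) = lookup m 0 + height m' i" for i
    by (simp add: height_def m' sum.atMost_Suc_shift del: sum.atMost_Suc)
  have "height m' i = r - lookup m 0" if "n \<le> i" for i
    using Suc.prems[of "Suc i"] height_m'[of i] that by simp
  then obtain \<sigma> where \<sigma>: "lattice_path n (r - lookup m 0) \<sigma>" "path_monomial \<sigma> = m'"
    using Suc.IH by blast
  let ?\<tau> = "replicate (lookup m 0) North @ East # \<sigma>"
  have "path_monomial ?\<tau> = m"
  proof (rule height_inject)
    fix i
    show "height (path_monomial ?\<tau>) i = height m i"
      by (cases i) (simp_all add: height_path_monomial_replicate height_path_monomial_East \<sigma>(2)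
        height_m' flip: height_0)
  qed
  moreover have "lookup m 0 \<le> r"
    using Suc.prems[of "Suc n"] height_m'[of n] by simp
  then have "lattice_path (Suc n) r ?\<tau>"
    using \<sigma>(1) by (simp add: lattice_path_def count_list_replicate)
  ultimately show ?case by blast
qed

lemma path_above_iff:
  assumes "lattice_path n r \<sigma>" "lattice_path n r \<tau>"
  shows "\<sigma> \<succeq> \<tau> \<longleftrightarrow> (\<forall>i<n. height (path_monomial \<tau>) i \<le> height (path_monomial \<sigma>) i)"
  using assms by (simp add: path_above_def east_heights_path_monomial lattice_path_def
      list_all2_conv_all_nth)

text \<open>From index \<open>n\<close> on both bounding heights equal \<open>r\<close>, so the
  bounds also force the degree of \<open>m\<close> to be \<open>r\<close> and exclude variables with
  index above \<open>n\<close>. Such an \<open>m\<close> comes from a path, and below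
  \<open>n\<close> the bounds are the two path comparisons.\<close>

lemma bases_heights:
  assumes "lattice_path n r \<alpha>" "lattice_path n r \<omega>"
  shows "bases (lattice_path_polymatroid n r \<alpha> \<omega>) =
    {m. \<forall>i. height (path_monomial \<omega>) i \<le> height m i \<and> height m i \<le> height (path_monomial \<alpha>) i}"
    (is "_ = ?R")
proof -
  have const: "height (path_monomial \<sigma>) i = r" if "lattice_path n r \<sigma>" "n \<le> i" for \<sigma> i
    using that height_path_monomial_eq_North by (auto simp: lattice_path_def)
  have path_R: "path_monomial \<sigma> \<in> ?R \<longleftrightarrow> \<alpha> \<succeq> \<sigma> \<and> \<sigma> \<succeq> \<omega>" if "lattice_path n r \<sigma>" for \<sigma>
    using that assms const by (auto simp: path_above_iff) (metis le_eq_less_or_eq linorder_not_le)+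
  have "\<exists>\<sigma>. lattice_path n r \<sigma> \<and> path_monomial \<sigma> = m" if "m \<in> ?R" for m
    using that const[OF assms(1)] const[OF assms(2)]
    by (intro lattice_path_of_heights) (metis (lifting) le_antisym mem_Collect_eq)
  then show ?thesis
    unfolding bases_lattice_path_polymatroid using path_R by blast
qed


subsection \<open>Symmetric exchanges and sorted pairs\<close>

text \<open>Paths are forgotten from here on: the bases are a box in height coordinates. All bases
  have degree \<open>r\<close>, and \<open>r > 0\<close> lets the number of factors of a product be
  read off from its toric image.\<close>

locale height_polymatroid =
  fixes \<Gamma> :: "nat monomial set" and n r :: nat and lo hi :: "nat \<Rightarrow> nat"
  assumes bases_iff: "m \<in> bases \<Gamma> \<longleftrightarrow> (\<forall>i. lo i \<le> height m i \<and> height m i \<le> hi i)"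
    and lo_const: "n \<le> i \<Longrightarrow> lo i = r" and hi_const: "n \<le> i \<Longrightarrow> hi i = r" and r_pos: "r > 0"
begin

lemma height_const: "m \<in> bases \<Gamma> \<Longrightarrow> n \<le> i \<Longrightarrow> height m i = r"
  using bases_iff lo_const hi_const by (metis le_antisym)

lemma height_le: "m \<in> bases \<Gamma> \<Longrightarrow> height m i \<le> r"
  using height_mono[of i "max i n" m] height_const[of m "max i n"] by simp

section \<open>Energy of a base and exchanges that lower it\<close>

definition area :: "nat monomial \<Rightarrow> nat"
  where "area m = (\<Sum>k<n. height m k)"

lemma area_le: "m \<in> bases \<Gamma> \<Longrightarrow> area m \<le> n * r"
  unfolding area_def using sum_bounded_above[of "{..<n}" "height m" r] height_le by simp

text \<open>The constant \<open>(n * r) ^ 2\<close> keeps the subtraction exact on bases, by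
  \<open>area_le\<close>, and cancels when two pairs are compared. The factor \<open>2 * n\<close>
  lets the sum of squares outweigh the area term when two heights differ by at least two.\<close>

definition energy :: "nat monomial \<Rightarrow> nat"
  where "energy m = 2 * n * (\<Sum>k<n. height m k ^ 2) + ((n * r) ^ 2 - area m ^ 2)"

lemma int_energy:
  assumes "m \<in> bases \<Gamma>"
  shows "int (energy m) = 2 * int n * (\<Sum>k<n. int (height m k) ^ 2) +
    (int n * int r) ^ 2 - (\<Sum>k<n. int (height m k)) ^ 2"
proof -
  have "area m ^ 2 \<le> (n * r) ^ 2" using area_le[OF assms] by (rule power_mono) simp
  then have "int (energy m) = 2 * int n * int (\<Sum>k<n. height m k ^ 2) +
      int ((n * r) ^ 2) - int (area m ^ 2)"
    unfolding energy_def by (subst of_nat_add) (simp add: of_nat_diff)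
  then show ?thesis by (simp add: area_def)
qed

text \<open>The exchange moves \<open>m\<close> down and \<open>m'\<close> up by one along a maximal run on which the height
  difference \<open>e\<close> attains its maximum \<open>M\<close>. If \<open>L\<close> is the length of the run, the energy changes by
  \<open>- 2 * L * (2 * n * (M - 1) + L + area m' - area m)\<close>.\<close>

lemma energy_decreasing_exchange:
  assumes m: "m \<in> bases \<Gamma>" and m': "m' \<in> bases \<Gamma>"
    and p: "height m' p < height m p"
    and big: "height m' p + 2 \<le> height m p \<or> area m \<le> area m'"
  shows "\<exists>u u'. symmetric_exchange \<Gamma> m m' u u' \<and> energy u + energy u' < energy m + energy m'"
proof -
  define e where "e k = int (height m k) - int (height m' k)" for k
  define M where "M = Max (e ` {..n})"
  have e0: "e k = 0" if "n \<le> k" for k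
    using that m m' by (simp add: e_def height_const)
  have e_le_n: "e k \<le> M" if "k \<le> n" for k
    unfolding M_def using that by (intro Max_ge) auto
  have e_le: "e k \<le> M" for k
    using e_le_n[of k] e_le_n[of n] e0[of k] e0[of n] by (cases "k \<le> n") auto
  have M_ge: "M \<ge> 1" using p e_le[of p] by (simp add: e_def)
  have "M \<in> e ` {..n}" unfolding M_def by (intro Max_in) auto
  then obtain q where q: "q \<le> n" "e q = M" by auto
  then have "q < n" using M_ge e0[of n] by (cases "q = n") auto
  \<comment> \<open>The maximal run through \<open>q\<close> is \<open>{i..<j}\<close>. It ends at
    \<open>n\<close> at the latest, since \<open>e n = 0 < M\<close>.\<close>
  define i where "i = (LEAST i. \<forall>k. i \<le> k \<and> k \<le> q \<longrightarrow> e k = M)"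
  define j where "j = (LEAST j. q < j \<and> e j \<noteq> M)"
  have iP: "\<forall>k. i \<le> k \<and> k \<le> q \<longrightarrow> e k = M"
    unfolding i_def by (rule LeastI[of _ q]) (use q in auto)
  have iq: "i \<le> q" unfolding i_def by (rule Least_le) (use q in auto)
  have jP: "q < j \<and> e j \<noteq> M"
    unfolding j_def by (rule LeastI[of _ n]) (use \<open>q < n\<close> e0[of n] M_ge in auto)
  have jn: "j \<le> n"
    unfolding j_def by (rule Least_le) (use \<open>q < n\<close> e0[of n] M_ge in auto)
  have j_min: "e k = M" if "q < k" "k < j" for k
    using not_less_Least[of k "\<lambda>j. q < j \<and> e j \<noteq> M"] that by (auto simp: j_def)
  have run: "e k = M" if "i \<le> k" "k < j" for k
    using that iP j_min by (cases "k \<le> q") auto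
  have i_max: "e (i - 1) < M" if "i > 0"
  proof -
    have "e (i - 1) \<noteq> M"
    proof
      assume *: "e (i - 1) = M"
      have "\<forall>k. i - 1 \<le> k \<and> k \<le> q \<longrightarrow> e k = M"
      proof (intro allI impI)
        fix k assume "i - 1 \<le> k \<and> k \<le> q"
        then show "e k = M" using * iP by (cases "k = i - 1") auto
      qed
      then have "i \<le> i - 1" unfolding i_def by (rule Least_le)
      then show False using that by simp
    qed
    then show ?thesis using e_le[of "i - 1"] by simp
  qed
  \<comment> \<open>By maximality of the run, \<open>e\<close> jumps up on entering \<open>i\<close>
    and down on entering \<open>j\<close>. Jumps of \<open>e\<close> are differences of degrees, so
    these are the strict inequalities a symmetric exchange requires. For \<open>i = 0\<close> the
    jump is from zero to \<open>M\<close>.\<close>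
  have lookup_i: "lookup m i > lookup m' i"
  proof (cases i)
    case 0
    then show ?thesis using run[of 0] iq jP M_ge by (simp add: e_def height_0)
  next
    case (Suc i')
    then show ?thesis
      using i_max run[of i] iq jP height_Suc[of m i'] height_Suc[of m' i'] by (simp add: e_def)
  qed
  have lookup_j: "lookup m j < lookup m' j"
  proof -
    obtain j' where j': "j = Suc j'" using jP by (cases j) auto
    have "e j' = M" using run[of j'] jP iq j' by simp
    moreover have "e j < M" using jP e_le[of j] by simp
    ultimately show ?thesis
      using height_Suc[of m j'] height_Suc[of m' j'] j' by (simp add: e_def)
  qed
  define u where "u = m - single i 1 + single j 1"
  define u' where "u' = m' - single j 1 + single i 1"
  define \<delta> where "\<delta> k = (if i \<le> k \<and> k < j then 1 else 0 :: nat)" for k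
  have ij: "i < j" using iq jP by simp
  have "m - single i 1 + single i 1 = m"
    by (rule poly_mapping_eqI) (use lookup_i in \<open>auto simp: lookup_add lookup_minus lookup_single when_def\<close>)
  then have hu: "height u k + \<delta> k = height m k" for k
    using height_add[of "m - single i 1" "single i 1" k] ij
    by (auto simp: u_def height_add height_single \<delta>_def)
  have "m' - single j 1 + single j 1 = m'"
    by (rule poly_mapping_eqI) (use lookup_j in \<open>auto simp: lookup_add lookup_minus lookup_single when_def\<close>)
  then have hu': "height u' k = height m' k + \<delta> k" for k
    using height_add[of "m' - single j 1" "single j 1" k] ij
    by (auto simp: u'_def height_add height_single \<delta>_def)
  \<comment> \<open>On the run \<open>e k = M\<close> is at least 1, so the new heights stay between
    those of \<open>m'\<close> and \<open>m\<close>, hence within the box.\<close>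
  have bounds: "height m' k + \<delta> k \<le> height m k" if "\<delta> k \<noteq> 0" for k
    using run[of k] M_ge that by (auto simp: \<delta>_def e_def split: if_splits)
  have u: "u \<in> bases \<Gamma>"
    unfolding bases_iff
  proof
    fix k show "lo k \<le> height u k \<and> height u k \<le> hi k"
      using bounds[of k] hu[of k] m m' unfolding bases_iff
      by (cases "\<delta> k = 0") (auto dest!: spec[of _ k])
  qed
  have u': "u' \<in> bases \<Gamma>"
    unfolding bases_iff
  proof
    fix k show "lo k \<le> height u' k \<and> height u' k \<le> hi k"
      using bounds[of k] hu'[of k] m m' unfolding bases_iff
      by (cases "\<delta> k = 0") (auto dest!: spec[of _ k])
  qed
  have exchange: "symmetric_exchange \<Gamma> m m' u u'"
    unfolding symmetric_exchange_def
    using m m' u u' lookup_i lookup_j u_def u'_def by blast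
  define x y d where "x k = int (height m k)" and "y k = int (height m' k)" and "d k = int (\<delta> k)" for k
  define L a b where "L = (\<Sum>k<n. d k)" and "a = (\<Sum>k<n. x k)" and "b = (\<Sum>k<n. y k)"
  have xu: "int (height u k) = x k - d k" and yu: "int (height u' k) = y k + d k" for k
    using hu[of k] hu'[of k] by (auto simp: x_def y_def d_def)
  have "d q \<le> L"
    unfolding L_def using \<open>q < n\<close> by (intro member_le_sum) (auto simp: d_def)
  then have L: "L \<ge> 1" using iq jP by (simp add: d_def \<delta>_def)
  \<comment> \<open>On the run \<open>x k = y k + M\<close>; moving both values one unit towards
    each other lowers the sum of squares by \<open>2 * (M - 1)\<close>.\<close>
  have "(x k - d k)^2 + (y k + d k)^2 = x k ^ 2 + y k ^ 2 - 2 * (M - 1) * d k" for k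
  proof (cases "\<delta> k = 0")
    case False
    then have "d k = 1" "x k = y k + M"
      using run[of k] by (auto simp: d_def \<delta>_def e_def x_def y_def split: if_splits)
    then show ?thesis by (simp add: power2_eq_square algebra_simps)
  qed (simp add: d_def)
  then have "(\<Sum>k<n. (x k - d k)^2 + (y k + d k)^2) =
      (\<Sum>k<n. x k ^ 2 + y k ^ 2 - 2 * (M - 1) * d k)"
    by simp
  then have sq: "(\<Sum>k<n. (x k - d k)^2) + (\<Sum>k<n. (y k + d k)^2) =
      (\<Sum>k<n. x k ^ 2) + (\<Sum>k<n. y k ^ 2) - 2 * (M - 1) * L"
    by (simp add: sum.distrib sum_subtractf sum_distrib_left L_def)
  have "int (energy u) + int (energy u') =
      2 * int n * ((\<Sum>k<n. (x k - d k)^2) + (\<Sum>k<n. (y k + d k)^2)) +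
      2 * (int n * int r)^2 - (a - L)^2 - (b + L)^2"
    unfolding int_energy[OF u] int_energy[OF u'] xu yu
    by (simp add: sum_subtractf sum.distrib a_def b_def L_def algebra_simps)
  moreover have "int (energy m) + int (energy m') =
      2 * int n * ((\<Sum>k<n. x k ^ 2) + (\<Sum>k<n. y k ^ 2)) + 2 * (int n * int r)^2 - a^2 - b^2"
    unfolding int_energy[OF m] int_energy[OF m'] by (simp add: a_def b_def x_def y_def algebra_simps)
  \<comment> \<open>The squares contribute \<open>4 * n * (M - 1) * L\<close>, and the areas
    contribute \<open>(a - L)^2 + (b + L)^2 - a^2 - b^2 = 2 * L * (L + b - a)\<close>.\<close>
  ultimately have diff: "int (energy m) + int (energy m') - (int (energy u) + int (energy u')) =
      2 * L * (2 * int n * (M - 1) + L + b - a)"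
    unfolding sq by (simp add: power2_eq_square algebra_simps)
  \<comment> \<open>If \<open>a\<close> is at most \<open>b\<close>, the term \<open>L\<close>
    suffices. Otherwise the gap at \<open>p\<close> gives \<open>M\<close> at least 2, so
    \<open>2 * n * (M - 1)\<close> is at least \<open>n * M\<close>, which bounds
    \<open>a - b\<close> as a sum of \<open>n\<close> differences.\<close>
  have "2 * int n * (M - 1) + L + b - a > 0"
  proof (cases "area m \<le> area m'")
    case True
    then have "a \<le> b" by (simp add: area_def a_def b_def x_def y_def flip: of_nat_sum)
    moreover have "2 * int n * (M - 1) \<ge> 0" using M_ge by simp
    ultimately show ?thesis using L by linarith
  next
    case False
    then have "M \<ge> 2" using big e_le[of p] by (simp add: e_def)
    then have "int n * M \<le> 2 * int n * (M - 1)"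
      using mult_left_mono[of 2 M "int n"] by (simp add: algebra_simps)
    moreover have "a - b = (\<Sum>k<n. e k)"
      by (simp add: a_def b_def x_def y_def e_def sum_subtractf)
    moreover have "(\<Sum>k<n. e k) \<le> int n * M"
      using sum_bounded_above[of "{..<n}" e M] e_le by simp
    ultimately show ?thesis using L by linarith
  qed
  then have "2 * L * (2 * int n * (M - 1) + L + b - a) > 0" using L by simp
  then have "energy u + energy u' < energy m + energy m'" using diff by linarith
  with exchange show ?thesis by blast
qed

text \<open>Equivalently, the heights of \<open>m\<close> and \<open>m'\<close> are half of their
  sum rounded down and up.\<close>

definition sorted_pair :: "nat monomial \<Rightarrow> nat monomial \<Rightarrow> bool"
  where "sorted_pair m m' \<longleftrightarrow> (\<forall>k. height m k \<le> height m' k \<and> height m' k \<le> height m k + 1)"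

text \<open>With a gap of two or more somewhere, the base that is higher there is lowered. Otherwise
  the two are close but incomparable, so each exceeds the other somewhere, and the base of smaller
  area is the one to lower.\<close>

lemma unsorted_exchange:
  assumes "m \<in> bases \<Gamma>" "m' \<in> bases \<Gamma>" "\<not> sorted_pair m m'" "\<not> sorted_pair m' m"
  shows "\<exists>u u'. (symmetric_exchange \<Gamma> m m' u u' \<or> symmetric_exchange \<Gamma> m' m u u') \<and>
    energy u + energy u' < energy m + energy m'"
proof -
  have "\<exists>p. (height m' p < height m p \<and> (height m' p + 2 \<le> height m p \<or> area m \<le> area m')) \<or>
      (height m p < height m' p \<and> (height m p + 2 \<le> height m' p \<or> area m' \<le> area m))"
  proof (cases "\<exists>p. height m' p + 2 \<le> height m p \<or> height m p + 2 \<le> height m' p")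
    case True
    then obtain p where "height m' p + 2 \<le> height m p \<or> height m p + 2 \<le> height m' p" by blast
    then show ?thesis by (intro exI[of _ p]) linarith
  next
    case False
    then have close: "height m' k \<le> height m k + 1" "height m k \<le> height m' k + 1" for k
      by (metis add.commute add_2_eq_Suc' Suc_eq_plus1 not_less_eq_eq add_Suc_right)+
    obtain p q where "height m' p < height m p" "height m q < height m' q"
      using assms(3,4) close unfolding sorted_pair_def by (metis linorder_not_le)
    then show ?thesis using nat_le_linear[of "area m" "area m'"] by blast
  qed
  then obtain p where "(height m' p < height m p \<and> (height m' p + 2 \<le> height m p \<or> area m \<le> area m')) \<or>
      (height m p < height m' p \<and> (height m p + 2 \<le> height m' p \<or> area m' \<le> area m))" ..
  then show ?thesis
    using energy_decreasing_exchange[OF assms(1,2), of p] energy_decreasing_exchange[OF assms(2,1), of p]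
    by (metis add.commute)
qed


subsection \<open>Sorted monomials are determined by their toric image\<close>

definition sorted_monomial :: "nat monomial monomial \<Rightarrow> bool"
  where "sorted_monomial t \<longleftrightarrow> (\<forall>m\<in>keys t. \<forall>m'\<in>keys t. sorted_pair m m' \<or> sorted_pair m' m)"

text \<open>The two inequalities force \<open>height h k\<close> to be the average of the heights over \<open>t\<close>, rounded up.\<close>

lemma sorted_monomial_largest:
  assumes t: "t \<in> monomials (bases \<Gamma>)" "sorted_monomial t" "t \<noteq> 0"
  shows "\<exists>h\<in>keys t. \<forall>k. height (toric_exp t) k \<le> (\<Sum>m\<in>keys t. lookup t m) * height h k \<and>
    (\<Sum>m\<in>keys t. lookup t m) * height h k < height (toric_exp t) k + (\<Sum>m\<in>keys t. lookup t m)"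
proof -
  have fin: "finite (keys t)" by simp
  have B: "m \<in> bases \<Gamma>" if "m \<in> keys t" for m using t(1) that by (auto simp: monomials_def)
  have "keys t \<noteq> {}" using t(3) by simp
  then obtain h where h: "h \<in> keys t" "\<And>m. m \<in> keys t \<Longrightarrow> area m \<le> area h"
    using arg_max_nat_lemma[of "\<lambda>m. m \<in> keys t" _ area "Suc (n * r)"] area_le B
    by (metis equals0I less_Suc_eq_le)
  \<comment> \<open>If instead \<open>sorted_pair h m\<close>, then \<open>m\<close> dominates
    \<open>h\<close> pointwise, and the maximal area of \<open>h\<close> forces equal
    heights.\<close>
  have near: "sorted_pair m h" if m: "m \<in> keys t" for m
  proof (cases "sorted_pair m h")
    case False
    then have *: "sorted_pair h m" using t(2) h(1) m unfolding sorted_monomial_def by blast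
    have "height m k = height h k" for k
    proof (cases "k < n")
      case True
      show ?thesis
      proof (rule ccontr)
        assume "height m k \<noteq> height h k"
        then have "height h k < height m k" using * by (simp add: sorted_pair_def le_neq_implies_less)
        then have "area h < area m"
          unfolding area_def using * True by (intro sum_strict_mono_ex1) (auto simp: sorted_pair_def)
        then show False using h(2)[OF m] by simp
      qed
    next
      case False
      then show ?thesis using height_const B m h(1) by simp
    qed
    then show ?thesis by (simp add: sorted_pair_def)
  qed
  have ht: "height (toric_exp t) k = (\<Sum>m\<in>keys t. lookup t m * height m k)" for k
    by (rule height_toric_exp) auto
  have "height (toric_exp t) k \<le> (\<Sum>m\<in>keys t. lookup t m) * height h k" for k
    unfolding ht sum_distrib_right using near by (intro sum_mono mult_le_mono2) (simp add: sorted_pair_def)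
  moreover have "(\<Sum>m\<in>keys t. lookup t m) * height h k <
      height (toric_exp t) k + (\<Sum>m\<in>keys t. lookup t m)" for k
  proof -
    \<comment> \<open>The inequality is strict at the summand of \<open>h\<close>, whose
      multiplicity is positive.\<close>
    have "(\<Sum>m\<in>keys t. lookup t m * height h k) < (\<Sum>m\<in>keys t. lookup t m * (height m k + 1))"
    proof (rule sum_strict_mono_ex1[OF fin])
      show "\<forall>m\<in>keys t. lookup t m * height h k \<le> lookup t m * (height m k + 1)"
        using near by (intro ballI mult_le_mono2) (simp add: sorted_pair_def)
      show "\<exists>m\<in>keys t. lookup t m * height h k < lookup t m * (height m k + 1)"
        using h(1) by (intro bexI[of _ h]) (simp_all add: in_keys_iff)
    qed
    then show ?thesis unfolding ht by (simp add: sum_distrib_right sum.distrib)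
  qed
  ultimately show ?thesis using h(1) by blast
qed

lemma sorted_monomial_subset:
  "keys t' \<subseteq> keys t \<Longrightarrow> sorted_monomial t \<Longrightarrow> sorted_monomial t'"
  unfolding sorted_monomial_def by (meson subsetD)

lemma height_toric_exp_n:
  assumes "t \<in> monomials (bases \<Gamma>)"
  shows "height (toric_exp t) n = (\<Sum>m\<in>keys t. lookup t m) * r"
proof -
  have "height (toric_exp t) n = (\<Sum>m\<in>keys t. lookup t m * height m n)"
    by (rule height_toric_exp) auto
  also have "\<dots> = (\<Sum>m\<in>keys t. lookup t m * r)"
    using assms height_const by (intro sum.cong) (auto simp: monomials_def)
  finally show ?thesis by (simp add: sum_distrib_right)
qed

text \<open>The largest variable is determined by the toric image, so it occurs in both monomials
  and can be cancelled. The induction is on the degree of the toric image, which is its height at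
  \<open>n\<close>.\<close>

lemma sorted_monomial_unique:
  assumes "s \<in> monomials (bases \<Gamma>)" "t \<in> monomials (bases \<Gamma>)"
    "sorted_monomial s" "sorted_monomial t" "toric_exp s = toric_exp t"
  shows "s = t"
  using assms
proof (induction "height (toric_exp t) n" arbitrary: s t rule: less_induct)
  case less
  let ?K = "\<lambda>t. \<Sum>m\<in>keys t. lookup t m"
  have K: "?K s = ?K t"
    using height_toric_exp_n[OF less.prems(1)] height_toric_exp_n[OF less.prems(2)]
      less.prems(5) r_pos by simp
  have K0: "?K v = 0 \<longleftrightarrow> v = 0" for v :: "nat monomial monomial"
    by (metis (mono_tags, lifting) finite_keys in_keys_iff keys_eq_empty sum_eq_0_iff equals0I sum.empty)
  show ?case
  proof (cases "t = 0")
    case True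
    then show ?thesis using K K0 by metis
  next
    case False
    then have "s \<noteq> 0" using K K0 by metis
    obtain g where g: "g \<in> keys s" "\<And>k. height (toric_exp s) k \<le> ?K s * height g k"
      "\<And>k. ?K s * height g k < height (toric_exp s) k + ?K s"
      using sorted_monomial_largest[OF less.prems(1,3) \<open>s \<noteq> 0\<close>] by blast
    obtain h where h: "h \<in> keys t" "\<And>k. height (toric_exp t) k \<le> ?K t * height h k"
      "\<And>k. ?K t * height h k < height (toric_exp t) k + ?K t"
      using sorted_monomial_largest[OF less.prems(2,4) False] by blast
    \<comment> \<open>With \<open>K\<close> the common number of factors and \<open>H\<close> the
      height of the toric image at \<open>k\<close>, both \<open>K * height g k\<close> and
      \<open>K * height h k\<close> lie in \<open>{H..<H + K}\<close>, which contains only one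
      multiple of \<open>K\<close>.\<close>
    have "g = h"
    proof (rule height_inject)
      fix k
      have "?K t * height g k < ?K t * (height h k + 1)" "?K t * height h k < ?K t * (height g k + 1)"
        using g(2,3)[of k] h(2,3)[of k] unfolding K less.prems(5) distrib_left mult_1_right by linarith+
      then show "height g k = height h k" unfolding mult_less_cancel1 by linarith
    qed
    obtain s' where s': "s = single h 1 + s'" "keys s' \<subseteq> keys s"
      using split_variable[OF g(1)] \<open>g = h\<close> by blast
    obtain t' where t': "t = single h 1 + t'" "keys t' \<subseteq> keys t"
      using split_variable[OF h(1)] by blast
    have "toric_exp s' = toric_exp t'"
      using less.prems(5) unfolding s'(1) t'(1) toric_exp_add by simp
    moreover have "h \<in> bases \<Gamma>" using h(1) less.prems(2) by (auto simp: monomials_def)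
    then have "height (toric_exp t') n < height (toric_exp t) n"
      unfolding t'(1) toric_exp_add height_add toric_exp_single_1 using height_const[of h n] r_pos by simp
    moreover note monomials_subset[OF s'(2) less.prems(1)] monomials_subset[OF t'(2) less.prems(2)]
      sorted_monomial_subset[OF s'(2) less.prems(3)] sorted_monomial_subset[OF t'(2) less.prems(4)]
    ultimately have "s' = t'" using less.hyps by blast
    then show ?thesis using s'(1) t'(1) by simp
  qed
qed

section \<open>Finiteness of the bases and reduction of unsorted monomials\<close>

lemma finite_bases: "finite (bases \<Gamma>)"
proof (rule inj_on_finite)
  show "inj_on (\<lambda>m. map (height m) [0..<n]) (bases \<Gamma>)"
  proof (rule inj_onI)
    fix m m' assume *: "m \<in> bases \<Gamma>" "m' \<in> bases \<Gamma>" "map (height m) [0..<n] = map (height m') [0..<n]"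
    show "m = m'"
    proof (rule height_inject)
      fix k show "height m k = height m' k"
        using * height_const by (cases "k < n") auto
    qed
  qed
  show "(\<lambda>m. map (height m) [0..<n]) ` bases \<Gamma> \<subseteq> {xs. set xs \<subseteq> {..r} \<and> length xs = n}"
    using height_le by auto
  show "finite {xs. set xs \<subseteq> {..r} \<and> length xs = n}"
    by (rule finite_lists_length_eq) simp
qed

text \<open>Unsorted monomials are reducible, so the least monomial of a fibre is sorted; by
  uniqueness it is the only sorted one. Every other monomial of the fibre is thus unsorted and
  reducible.\<close>

lemma symmetric_exchange_reduction:
  "\<exists>ord. toric_reduction \<Gamma> ord (symmetric_exchange_binomials \<Gamma>)"
proof -
  let ?M = "monomials (bases \<Gamma>)"
  obtain ord where ord: "monomial_order (bases \<Gamma>) ord"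
    and weight: "\<And>s t. s \<in> ?M \<Longrightarrow> t \<in> ?M \<Longrightarrow>
      weight (bases \<Gamma>) energy s < weight (bases \<Gamma>) energy t \<Longrightarrow> (s, t) \<in> ord"
    using monomial_order_of_weight[OF finite_bases, of energy] by blast
  have antisym: "antisym ord"
    using ord by (simp add: monomial_order_def well_order_on_def order_on_defs)
  have unsorted: "\<exists>a b c. t = a + c \<and> a \<in> ?M \<and> b \<in> ?M \<and> c \<in> ?M \<and> (b, a) \<in> ord \<and> b \<noteq> a \<and>
      monom a - monom b \<in> symmetric_exchange_binomials \<Gamma> \<and> toric_exp a = toric_exp b"
    if t: "t \<in> ?M" "\<not> sorted_monomial t" for t
  proof -
    obtain m m' where mm': "m \<in> keys t" "m' \<in> keys t" "\<not> sorted_pair m m'" "\<not> sorted_pair m' m"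
      using t(2) unfolding sorted_monomial_def by blast
    have B: "m \<in> bases \<Gamma>" "m' \<in> bases \<Gamma>" using mm'(1,2) t(1) by (auto simp: monomials_def)
    have "m \<noteq> m'" using mm'(3) by (auto simp: sorted_pair_def)
    obtain u u' where ex: "symmetric_exchange \<Gamma> m m' u u' \<or> symmetric_exchange \<Gamma> m' m u u'"
      and less: "energy u + energy u' < energy m + energy m'"
      using unsorted_exchange[OF B mm'(3,4)] by blast
    have Bu: "u \<in> bases \<Gamma>" "u' \<in> bases \<Gamma>" using ex by (auto simp: symmetric_exchange_def)
    let ?a = "single m 1 + single m' 1 :: nat monomial monomial"
      and ?b = "single u 1 + single u' 1 :: nat monomial monomial"
    obtain c' where c': "t = single m 1 + c'" "keys c' \<subseteq> keys t"
      using split_variable[OF mm'(1)] by blast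
    then have m'c': "m' \<in> keys c'"
      using mm'(2) \<open>m \<noteq> m'\<close> by (simp add: in_keys_iff lookup_add lookup_single)
    then obtain c where c: "c' = single m' 1 + c" "keys c \<subseteq> keys c'"
      using split_variable[OF m'c'] by blast
    have "t = ?a + c" using c'(1) c(1) by (simp add: add.assoc)
    moreover have aM: "?a \<in> ?M" and bM: "?b \<in> ?M" using B Bu by (simp_all only: pair_in_monomials)
    moreover have "c \<in> ?M" using c(2) c'(2) t(1) by (auto simp: monomials_def)
    moreover have less': "weight (bases \<Gamma>) energy ?b < weight (bases \<Gamma>) energy ?a"
      using less B Bu finite_bases by (simp only: weight_add weight_single)
    moreover have "(?b, ?a) \<in> ord" using weight[OF bM aM less'] .
    \<comment> \<open>The exchange may start from either base of the pair, but the binomial is the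
      same because the variables commute.\<close>
    moreover have "Y m * Y m' - Y u * Y u' \<in> symmetric_exchange_binomials \<Gamma>"
      using ex
    proof
      assume "symmetric_exchange \<Gamma> m m' u u'"
      then show ?thesis unfolding symmetric_exchange_binomials_def by blast
    next
      assume "symmetric_exchange \<Gamma> m' m u u'"
      then have "Y m' * Y m - Y u * Y u' \<in> symmetric_exchange_binomials \<Gamma>"
        unfolding symmetric_exchange_binomials_def by blast
      then show ?thesis by (simp only: mult.commute[of "Y m'"])
    qed
    then have "monom ?a - monom ?b \<in> symmetric_exchange_binomials \<Gamma>"
      by (simp only: Y_mult)
    moreover have "m + m' = u + u'"
      using ex exchange_preserves_product[of \<Gamma> m m' u u'] exchange_preserves_product[of \<Gamma> m' m u u']
      by (auto simp only: add.commute[of m'])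
    then have "toric_exp ?a = toric_exp ?b"
      by (simp only: toric_exp_add toric_exp_single_1)
    moreover have "?b \<noteq> ?a" using less' by auto
    ultimately show ?thesis by (intro exI[of _ ?a] exI[of _ ?b] exI[of _ c] conjI)
  qed
  \<comment> \<open>Otherwise the reduced monomial \<open>b + c\<close> would lie strictly below
    \<open>t\<close> in the same fibre.\<close>
  have "sorted_monomial t"
    if t: "t \<in> ?M" and min: "\<And>u. u \<in> ?M \<Longrightarrow> toric_exp u = toric_exp t \<Longrightarrow> (t, u) \<in> ord" for t
  proof (rule ccontr)
    assume "\<not> sorted_monomial t"
    then obtain a b c where abc: "t = a + c" "b \<in> ?M" "c \<in> ?M" "(b, a) \<in> ord" "b \<noteq> a"
      "toric_exp a = toric_exp b"
      using unsorted[OF t] by blast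
    have "(b + c, t) \<in> ord" using abc ord by (simp add: monomial_order_def)
    moreover have "(t, b + c) \<in> ord"
      using abc by (intro min monomials_add) (simp_all add: toric_exp_add)
    ultimately have "b + c = t" using antisym by (blast dest: antisymD)
    then show False using abc(1,5) by simp
  qed
  note min_sorted = this
  have "\<exists>a b c. t = a + c \<and> a \<in> ?M \<and> b \<in> ?M \<and> c \<in> ?M \<and> (b, a) \<in> ord \<and> b \<noteq> a \<and>
      monom a - monom b \<in> symmetric_exchange_binomials \<Gamma>"
    if st: "s \<in> ?M" "t \<in> ?M" "toric_exp s = toric_exp t" "(s, t) \<in> ord" "s \<noteq> t" for s t
  proof -
    obtain z where z: "z \<in> ?M" "toric_exp z = toric_exp t"
      "\<And>u. u \<in> ?M \<Longrightarrow> toric_exp u = toric_exp t \<Longrightarrow> (z, u) \<in> ord"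
      using fibre_minimum[OF ord st(2)] by blast
    \<comment> \<open>A sorted \<open>t\<close> would coincide with the fibre minimum
      \<open>z\<close>, leaving no room for \<open>s\<close> strictly below it.\<close>
    have "\<not> sorted_monomial t"
    proof
      assume "sorted_monomial t"
      moreover have "sorted_monomial z" using z by (intro min_sorted) auto
      ultimately have "z = t" using sorted_monomial_unique z(1,2) st(2) by blast
      then have "(t, s) \<in> ord" using z(3) st(1,3) by blast
      then show False using antisymD[OF antisym st(4)] st(5) by blast
    qed
    then show ?thesis using unsorted[OF st(2)] by blast
  qed
  then have "toric_reduction \<Gamma> ord (symmetric_exchange_binomials \<Gamma>)"
    using ord finite_symmetric_exchange_binomials[OF finite_bases] symmetric_exchange_binomials_toric
    by (intro toric_reduction.intro) simp_all
  then show ?thesis ..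
qed

end

theorem theorem3p1:
  fixes n r :: nat and \<alpha> \<omega> :: "step list" and \<Gamma> :: "nat monomial set"
  assumes "n > 0" and "r > 0"
    and "lattice_path n r \<alpha>" and "lattice_path n r \<omega>" and "\<alpha> \<succeq> \<omega>"
    and "\<Gamma> = lattice_path_polymatroid n r \<alpha> \<omega>"
  shows "toric_ideal \<Gamma> = Idl\<^bsub>base_ring \<Gamma>\<^esub> (symmetric_exchange_binomials \<Gamma>)
    \<and> (\<exists>ord. monomial_order (bases \<Gamma>) ord \<and>
         groebner_basis (bases \<Gamma>) ord (symmetric_exchange_binomials \<Gamma>) (toric_ideal \<Gamma>))"
proof -
  interpret height_polymatroid \<Gamma> n r "height (path_monomial \<omega>)" "height (path_monomial \<alpha>)"
  proof
    show "m \<in> bases \<Gamma> \<longleftrightarrow> (\<forall>i. height (path_monomial \<omega>) i \<le> height m i \<and>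
        height m i \<le> height (path_monomial \<alpha>) i)" for m
      unfolding assms(6) bases_heights[OF assms(3,4)] by simp
  qed (use assms(2-4) height_path_monomial_eq_North in \<open>auto simp: lattice_path_def\<close>)
  obtain ord where "toric_reduction \<Gamma> ord (symmetric_exchange_binomials \<Gamma>)"
    using symmetric_exchange_reduction by blast
  then interpret toric_reduction \<Gamma> ord "symmetric_exchange_binomials \<Gamma>" .
  show ?thesis using toric_ideal_eq groebner order by blast
qed

end
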